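(* Let $A(\bm{x})=Q^{\mathrm{T}}K(\bm{x})^{-1}Q\in\mathbb{S}^n$, let $$S=\{\bm{x}\in\mathbb{R}^m:\ \bm{l}^{\mathrm{T}}\bm{x}\le V_0,\ x_{\min}\le x_j\ (j=1,\ldots,m)\},$$ which is compact, and for $\mu>0$ let $$f_\mu(\bm{x})=\mu\log\left(\sum_{i=1}^n\exp\left(\frac{\lambda_i(A(\bm{x}))}{\mu}\right)\right)-\mu\log n,$$ with $f_0(\bm{x})=\lambda_1(A(\bm{x}))$. Then: (1) for every $\mu>0$, $f_\mu$ is convex over $S$; (2) there exist constants $L,L'>0$, independent of $\mu$, such that for every $\mu>0$ the gradient $\nabla f_\mu$ is $(L'+L/\mu)$-Lipschitz continuous over $S$; (3) $0\le f_{\mu_2}(\bm{x})-f_{\mu_1}(\bm{x})\le(\log n)(\mu_1-\mu_2)$ for any $\bm{x}\in S$ and $\mu_1\ge\mu_2\ge 0$.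
   Context: Notation: $\mathbb{S}^n$ is the space of real symmetric $n\times n$ matrices, $\mathbb{S}^d_{\succeq 0}$ the set of positive semidefinite matrices in $\mathbb{S}^d$; $\lambda_i(X)$ is the $i$-th largest eigenvalue of $X\in\mathbb{S}^n$ (counted with multiplicity), so $\lambda_1(X)$ is the maximum eigenvalue; $\mathbb{R}^m_{>0}$ is the set of vectors in $\mathbb{R}^m$ with all components positive; Lipschitz continuity is with respect to the Euclidean norm. Data: $K(\bm{x})=\sum_{j=1}^m x_jK_j$ with constant matrices $K_j\in\mathbb{S}^d_{\succeq 0}$ ($j=1,\ldots,m$), such that $K(\bm{x})$ is positive definite whenever $\bm{x}\in\mathbb{R}^m_{>0}$; $Q\in\mathbb{R}^{d\times n}$ is a constant matrix; $\bm{l}\in\mathbb{R}^m$ has all components positive; $V_0>0$ and $x_{\min}>0$ are constants. The functions $A$ and $f_\mu$ are defined on $\mathbb{R}^m_{>0}\supseteq S$. The set $S$ is the feasible set of the robust compliance minimization problem: minimize $\lambda_1(Q^{\mathrm{T}}K(\bm{x})^{-1}Q)$ over $\bm{x}\in S$. *)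

theory Defs
  imports "HOL-Analysis.Analysis" "HOL-Computational_Algebra.Computational_Algebra"
begin

definition psd :: "real^'d^'d \<Rightarrow> bool" where
  "psd M \<longleftrightarrow> transpose M = M \<and> (\<forall>v. 0 \<le> v \<bullet> (M *v v))"

definition pos_def :: "real^'d^'d \<Rightarrow> bool" where
  "pos_def M \<longleftrightarrow> transpose M = M \<and> (\<forall>v. v \<noteq> 0 \<longrightarrow> 0 < v \<bullet> (M *v v))"

text \<open>The characteristic polynomial, as the determinant of \<open>X I - M\<close> over the polynomial ring.\<close>

definition charpoly :: "real^'n^'n \<Rightarrow> real poly" where
  "charpoly M = det (\<chi> i j. (if i = j then [:0, 1:] else 0) - [:M $ i $ j:])"

text \<open>The \<open>i\<close>-th largest eigenvalue (\<open>i = 1, \<dots>, CARD('n)\<close>), counted with multiplicity.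
  Only real roots are collected, so this is the intended notion for symmetric matrices, where
  the list has exactly \<open>CARD('n)\<close> entries.\<close>

definition lam :: "nat \<Rightarrow> real^'n^'n \<Rightarrow> real" where
  "lam i M = rev (sorted_list_of_multiset (proots (charpoly M))) ! (i - 1)"

definition stiffness :: "('m \<Rightarrow> real^'d^'d) \<Rightarrow> real^'m \<Rightarrow> real^'d^'d" where
  "stiffness Ks x = (\<Sum>j\<in>UNIV. (x $ j) *\<^sub>R Ks j)"

definition compliance :: "('m \<Rightarrow> real^'d^'d) \<Rightarrow> real^'n^'d \<Rightarrow> real^'m \<Rightarrow> real^'n^'n" where
  "compliance Ks Q x = transpose Q ** matrix_inv (stiffness Ks x) ** Q"

definition feasible :: "real^'m \<Rightarrow> real \<Rightarrow> real \<Rightarrow> (real^'m) set" where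
  "feasible l V0 xmin = {x. l \<bullet> x \<le> V0 \<and> (\<forall>j. xmin \<le> x $ j)}"

definition smoothed ::
    "('m \<Rightarrow> real^'d^'d) \<Rightarrow> real^'n^'d \<Rightarrow> real \<Rightarrow> real^'m \<Rightarrow> real" where
  "smoothed Ks Q \<mu> x =
     (if \<mu> = 0 then lam 1 (compliance Ks Q x)
      else \<mu> * ln (\<Sum>i = 1..CARD('n). exp (lam i (compliance Ks Q x) / \<mu>))
           - \<mu> * ln (real CARD('n)))"

text \<open>Sanity check: the roots of \<^const>\<open>charpoly\<close> are the eigenvalues.\<close>

lemma poly_charpoly: "poly (charpoly M) c = det (c *\<^sub>R mat 1 - M)"
  unfolding charpoly_def det_def
  by (auto simp: poly_sum poly_prod of_int_poly mat_def intro!: sum.cong prod.cong)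

lemma charpoly_root_iff: "poly (charpoly M) c = 0 \<longleftrightarrow> (\<exists>v. v \<noteq> 0 \<and> M *v v = c *\<^sub>R v)"
proof -
  have "poly (charpoly M) c = 0 \<longleftrightarrow> (\<exists>v. v \<noteq> 0 \<and> (c *\<^sub>R mat 1 - M) *v v = 0)"
    unfolding poly_charpoly
    by (metis invertible_det_nz invertible_left_inverse matrix_left_invertible_ker)
  then show ?thesis
    by (auto simp: matrix_vector_mult_diff_rdistrib scaleR_matrix_vector_assoc [symmetric])
qed

end

theory Submission
  imports Defs
begin

text \<open>
  Write \<open>f\<close> for the smoothed function with parameter \<open>\<mu>\<close> and \<open>A\<close> for the compliance matrix. Statements (1) and (2)
  both follow from the two-sided estimate
  \<open>f x + g x \<bullet> (y - x) \<le> f y \<le> f x + g x \<bullet> (y - x) + (C + D / \<mu>) * \<bar>y - x\<bar>\<^sup>2\<close>, in which the upper bound is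
  needed only for nearby \<open>x\<close>, \<open>y\<close> in a neighbourhood of the feasible set: it makes \<open>g\<close> the gradient,
  \<open>f\<close> convex, and \<open>g\<close> Lipschitz with twice the quadratic constant. The lower bound comes from
  Peierls' inequality for the eigenbasis of \<open>A x\<close>, the upper one from a quantitative converse of
  Klein's inequality comparing the eigenbases of \<open>A x\<close> and \<open>A y\<close>, so no derivative of an eigenvalue
  is ever taken. Statement (3) is the monotonicity of power means and of \<open>p\<close>-norms.
\<close>

subsection \<open>Eigensystems of symmetric matrices\<close>

text \<open>For small t of the sign opposite to b the linear term would outweigh the quadratic one.
  This serves as first-order condition at the maximiser of a Rayleigh quotient.\<close>

lemma linear_term_eq_0_if_quadratic_nonneg:
  fixes a b :: real
  assumes "\<And>t. 0 \<le> 2 * t * b + t\<^sup>2 * a"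
  shows "b = 0"
proof (rule ccontr)
  assume "b \<noteq> 0"
  \<comment> \<open>With this t, t^2 * (|a| + 1) = - t * b, so the quadratic term offsets at most
    half of \<open>2 * t * b\<close>.\<close>
  define t where "t = - b / (\<bar>a\<bar> + 1)"
  have "t\<^sup>2 * a \<le> t\<^sup>2 * (\<bar>a\<bar> + 1)"
    by (intro mult_left_mono) auto
  also have "\<dots> = - (t * b)"
    by (simp add: t_def power2_eq_square)
  finally have "0 \<le> t * b"
    using assms[of t] by linarith
  moreover have "t * b = - (b\<^sup>2 / (\<bar>a\<bar> + 1))"
    by (simp add: t_def power2_eq_square)
  moreover have "0 < b\<^sup>2 / (\<bar>a\<bar> + 1)"
    using \<open>b \<noteq> 0\<close> by (simp add: zero_less_divide_iff)
  ultimately show False by linarith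
qed

text \<open>A unit vector of \<open>S\<close> maximising \<open>x \<bullet> f x\<close> is an
  eigenvector; compactness of the unit sphere of \<open>S\<close> supplies it.\<close>

lemma selfadjoint_eigenvector_exists:
  fixes f :: "'a::euclidean_space \<Rightarrow> 'a"
  assumes f: "linear f" and sym: "\<And>x y. x \<bullet> f y = f x \<bullet> y"
    and S: "subspace S" "S \<noteq> {0}" and inv: "\<And>x. x \<in> S \<Longrightarrow> f x \<in> S"
  obtains x c where "x \<in> S" "norm x = 1" "f x = c *\<^sub>R x"
proof -
  let ?K = "S \<inter> sphere 0 1"
  have K: "compact ?K"
    using S by (simp add: closed_subspace closed_Int_compact)
  obtain w where w: "w \<in> S" "w \<noteq> 0"
    using S subspace_0 by blast
  have "(1 / norm w) *\<^sub>R w \<in> ?K"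
    using w S by (simp add: subspace_scale)
  then have "?K \<noteq> {}" by blast
  moreover have "continuous_on ?K (\<lambda>x. x \<bullet> f x)"
    using f by (intro continuous_intros linear_continuous_on) (simp add: linear_conv_bounded_linear)
  ultimately obtain x where x: "x \<in> ?K" and max: "\<And>y. y \<in> ?K \<Longrightarrow> y \<bullet> f y \<le> x \<bullet> f x"
    using continuous_attains_sup[OF K] by blast
  define c where "c = x \<bullet> f x"
  have xx: "x \<in> S" "x \<bullet> x = 1"
    using x by (auto simp: norm_eq_1)
  have le: "y \<bullet> f y \<le> c * (y \<bullet> y)" if "y \<in> S" for y
  proof (cases "y = 0")
    case False
    let ?z = "(1 / norm y) *\<^sub>R y"
    have "?z \<in> ?K"
      using that False S by (simp add: subspace_scale)
    then have "?z \<bullet> f ?z \<le> c"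
      using max c_def by blast
    then have "(y \<bullet> f y) / (norm y)\<^sup>2 \<le> c"
      by (simp add: linear_cmul[OF f] power2_eq_square)
    then show ?thesis
      using False by (simp add: divide_le_eq power2_norm_eq_inner)
  qed simp
  \<comment> \<open>The residual lies in \<open>S\<close>, so x may be perturbed along it. The
    resulting polynomial in t is nonnegative by \<open>le\<close>, and its linear term
    \<open>2 * t * (r \<bullet> r)\<close> must vanish.\<close>
  define r where "r = c *\<^sub>R x - f x"
  have "r \<in> S"
    unfolding r_def using xx inv S by (intro subspace_diff subspace_scale) auto
  have "r \<bullet> r = 0"
  proof (rule linear_term_eq_0_if_quadratic_nonneg)
    fix t :: real
    have "x + t *\<^sub>R r \<in> S"
      using xx \<open>r \<in> S\<close> S by (intro subspace_add subspace_scale) auto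
    from le[OF this]
    have "0 \<le> c * ((x + t *\<^sub>R r) \<bullet> (x + t *\<^sub>R r)) - (x + t *\<^sub>R r) \<bullet> f (x + t *\<^sub>R r)" by simp
    also have "\<dots> = 2 * t * (r \<bullet> r) + t\<^sup>2 * (c * (r \<bullet> r) - r \<bullet> f r)"
      using sym[of x r] xx
      by (simp add: linear_add[OF f] linear_cmul[OF f] inner_add_left inner_add_right
          c_def [symmetric] power2_eq_square algebra_simps)
        (simp add: r_def inner_diff_left inner_diff_right inner_commute algebra_simps)
    finally show "0 \<le> 2 * t * (r \<bullet> r) + t\<^sup>2 * (c * (r \<bullet> r) - r \<bullet> f r)" .
  qed
  then have "f x = c *\<^sub>R x"
    by (simp add: r_def)
  then show thesis
    using that xx by (metis norm_eq_1)
qed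

text \<open>Induction on the dimension: split off one unit eigenvector; its orthogonal complement in
  \<open>S\<close> is again invariant because \<open>f\<close> is self-adjoint.\<close>

lemma selfadjoint_orthonormal_eigenbasis_subspace:
  fixes f :: "'a::euclidean_space \<Rightarrow> 'a"
  assumes f: "linear f" and sym: "\<And>x y. x \<bullet> f y = f x \<bullet> y"
    and "subspace S" "\<And>x. x \<in> S \<Longrightarrow> f x \<in> S"
  shows "\<exists>B. B \<subseteq> S \<and> finite B \<and> card B = dim S \<and> pairwise orthogonal B
    \<and> (\<forall>b\<in>B. norm b = 1 \<and> (\<exists>c. f b = c *\<^sub>R b))"
  using assms(3,4)
proof (induction "dim S" arbitrary: S)
  case 0
  then show ?case by (intro exI[of _ "{}"]) auto
next
  case (Suc n)
  then have "S \<noteq> {0}" by auto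
  then obtain x c where x: "x \<in> S" "norm x = 1" "f x = c *\<^sub>R x"
    using selfadjoint_eigenvector_exists[OF f sym Suc.prems(1)] Suc.prems(2) by metis
  define T where "T = {y \<in> S. \<forall>z\<in>span {x}. orthogonal z y}"
  have T: "T = {y \<in> S. x \<bullet> y = 0}"
    by (auto simp: T_def orthogonal_def span_singleton)
  have "span {x} \<subseteq> S"
    using x Suc.prems(1) by (simp add: span_minimal)
  then have "dim T + dim (span {x}) = dim S"
    unfolding T_def by (intro dim_subspace_orthogonal_to_vectors Suc.prems subspace_span)
  moreover have "dim (span {x}) = 1"
    using x by (auto simp: dim_span dim_eq_card_independent)
  ultimately have "n = dim T"
    using Suc.hyps(2) by simp
  moreover have "subspace T"
    using Suc.prems(1) unfolding T subspace_def by (auto simp: inner_add_right)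
  moreover have "f y \<in> T" if "y \<in> T" for y
    using that Suc.prems(2) sym[of x y] x(3) by (auto simp: T)
  ultimately obtain B where B: "B \<subseteq> T" "finite B" "card B = dim T" "pairwise orthogonal B"
      "\<forall>b\<in>B. norm b = 1 \<and> (\<exists>c. f b = c *\<^sub>R b)"
    using Suc.hyps(1)[of T] by blast
  have "x \<notin> B"
    using B(1) x(2) by (auto simp: T norm_eq_1)
  then have "card (insert x B) = dim S"
    using B \<open>n = dim T\<close> Suc.hyps(2) by simp
  moreover have "pairwise orthogonal (insert x B)"
    using B(1,4) by (auto simp: pairwise_insert orthogonal_def T inner_commute)
  moreover have "insert x B \<subseteq> S"
    using B(1) x(1) by (auto simp: T)
  ultimately show ?case
    using B x by (intro exI[of _ "insert x B"]) auto
qed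

text \<open>Indexing by the coordinate type leaves the eigenvalues unordered. This suffices because
  the smoothed function sees them only through sums over all of them or through their
  maximum.\<close>

definition eigensystem :: "real^'n^'n \<Rightarrow> ('n \<Rightarrow> real^'n) \<Rightarrow> ('n \<Rightarrow> real) \<Rightarrow> bool" where
  "eigensystem M u e \<longleftrightarrow> transpose M = M \<and>
     (\<forall>i j. u i \<bullet> u j = (if i = j then 1 else 0)) \<and> (\<forall>i. M *v u i = e i *\<^sub>R u i)"

lemma symmetric_matrix_inner:
  fixes M :: "real^'n^'n"
  assumes "transpose M = M"
  shows "x \<bullet> (M *v y) = (M *v x) \<bullet> y"
  by (metis assms dot_lmul_matrix transpose_matrix_vector)

lemma symmetric_eigensystem_exists:
  fixes M :: "real^'n^'n"
  assumes "transpose M = M"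
  obtains u e where "eigensystem M u e"
proof -
  obtain B where B: "finite B" "card B = CARD('n)" "pairwise orthogonal B"
      "\<forall>b\<in>B. norm b = 1 \<and> (\<exists>c. M *v b = c *\<^sub>R b)"
    using selfadjoint_orthonormal_eigenbasis_subspace[of "(*v) M" UNIV]
      symmetric_matrix_inner[OF assms] by (auto simp: dim_UNIV)
  then obtain u where u: "bij_betw u (UNIV :: 'n set) B"
    using finite_same_card_bij[of "UNIV :: 'n set" B] by auto
  obtain c where c: "\<And>b. b \<in> B \<Longrightarrow> M *v b = c b *\<^sub>R b"
    using B(4) by metis
  have uB: "u i \<in> B" for i
    using u by (auto simp: bij_betw_def)
  have "u i \<bullet> u j = (if i = j then 1 else 0)" for i j
    using B(3,4) uB[of i] uB[of j] u unfolding pairwise_def orthogonal_def bij_betw_def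
    by (auto simp: norm_eq_1 dest: injD)
  then show thesis
    using that[of u "c \<circ> u"] c uB by (simp add: eigensystem_def assms)
qed

lemma orthonormal_family_matrix:
  fixes u :: "'n::finite \<Rightarrow> real^'n"
  assumes "\<And>i j. u i \<bullet> u j = (if i = j then 1 else 0)"
  shows "orthogonal_matrix (\<chi> i. u i)"
proof -
  have "(\<chi> i. u i) ** transpose (\<chi> i. u i) = mat 1"
    using assms by (simp add: vec_eq_iff matrix_matrix_mult_def transpose_def mat_def inner_vec_def)
  then show ?thesis
    by (simp add: orthogonal_matrix_def matrix_left_right_inverse)
qed

lemma orthonormal_family_parseval:
  fixes u :: "'n::finite \<Rightarrow> real^'n"
  assumes "\<And>i j. u i \<bullet> u j = (if i = j then 1 else 0)"
  shows "(\<Sum>i\<in>UNIV. (u i \<bullet> x) * (u i \<bullet> y)) = x \<bullet> y"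
proof -
  let ?P = "\<chi> i. u i"
  have "(\<Sum>i\<in>UNIV. (u i \<bullet> x) * (u i \<bullet> y)) = (?P *v x) \<bullet> (?P *v y)"
    by (simp add: inner_vec_def[of "?P *v x"] matrix_vector_mul_component)
  also have "\<dots> = x \<bullet> ((transpose ?P ** ?P) *v y)"
    by (metis dot_lmul_matrix matrix_vector_mul_assoc transpose_matrix_vector transpose_transpose)
  also have "\<dots> = x \<bullet> y"
    using orthonormal_family_matrix[OF assms] by (simp add: orthogonal_matrix_def)
  finally show ?thesis .
qed

text \<open>Conjugation with the orthogonal matrix of rows \<open>u i\<close> makes
  \<open>c *\<^sub>R mat 1 - M\<close> diagonal and preserves its determinant, for every c.\<close>

lemma charpoly_eigensystem:
  assumes "eigensystem M u e"
  shows "charpoly M = (\<Prod>i\<in>UNIV. [:- e i, 1:])"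
proof (rule poly_ext)
  fix c
  let ?P = "\<chi> i. u i"
  have P: "orthogonal_matrix ?P"
    using assms by (intro orthonormal_family_matrix) (auto simp: eigensystem_def)
  have "(?P ** (c *\<^sub>R mat 1 - M)) ** transpose ?P = (\<chi> i j. u i \<bullet> ((c *\<^sub>R mat 1 - M) *v u j))"
    by (simp add: vec_eq_iff matrix_mul_assoc [symmetric])
      (simp add: matrix_matrix_mult_def transpose_def inner_vec_def matrix_vector_mult_def)
  also have "\<dots> = (\<chi> i j. if i = j then c - e i else 0)"
  proof -
    have "u i \<bullet> ((c *\<^sub>R mat 1 - M) *v u j) = (if i = j then c - e i else 0)" for i j
      using assms by (simp add: eigensystem_def matrix_vector_mult_diff_rdistrib
          inner_diff_right scaleR_matrix_vector_assoc [symmetric])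
    then show ?thesis by presburger
  qed
  finally have "det ((?P ** (c *\<^sub>R mat 1 - M)) ** transpose ?P) = (\<Prod>i\<in>UNIV. c - e i)"
    by (simp add: det_diagonal)
  moreover have "det ((?P ** (c *\<^sub>R mat 1 - M)) ** transpose ?P) = det (c *\<^sub>R mat 1 - M)"
    using det_orthogonal_matrix[OF P] by (auto simp: det_mul det_transpose)
  ultimately show "poly (charpoly M) c = poly (\<Prod>i\<in>UNIV. [:- e i, 1:]) c"
    by (simp add: poly_charpoly poly_prod)
qed

lemma mset_lam_eigensystem:
  assumes "eigensystem M u e"
  shows "mset (rev (sorted_list_of_multiset (proots (charpoly M)))) = image_mset e (mset_set UNIV)"
proof -
  have "proots (charpoly M) = (\<Sum>i\<in>UNIV. {#e i#})"
    by (simp add: charpoly_eigensystem[OF assms] proots_prod)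
  also have "\<dots> = image_mset e (mset_set UNIV)"
    by (simp add: sum_unfold_sum_mset)
  finally show ?thesis by simp
qed

lemma sum_lam_eigensystem:
  fixes M :: "real^'n^'n"
  assumes "eigensystem M u e"
  shows "(\<Sum>i = 1..CARD('n). \<phi> (lam i M)) = (\<Sum>i\<in>UNIV. \<phi> (e i) :: real)"
proof -
  define L where "L = rev (sorted_list_of_multiset (proots (charpoly M)))"
  have L: "mset L = image_mset e (mset_set UNIV)"
    using mset_lam_eigensystem[OF assms] by (simp add: L_def)
  have len: "length L = CARD('n)"
    using arg_cong[OF L, of size] by simp
  have "(\<Sum>i = 1..CARD('n). \<phi> (lam i M)) = (\<Sum>i = 1..CARD('n). \<phi> (L ! (i - 1)))"
    by (simp add: lam_def L_def)
  also have "\<dots> = (\<Sum>i<length L. \<phi> (L ! i))"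
    \<comment> \<open>\<open>lam\<close> counts from 1, list positions from 0.\<close>
    unfolding len by (rule sum.reindex_bij_witness[of _ Suc "\<lambda>i. i - 1"]) auto
  also have "\<dots> = sum_mset (image_mset \<phi> (mset L))"
    by (simp add: sum_list_sum_nth sum_mset_sum_list atLeast0LessThan flip: mset_map)
  also have "\<dots> = (\<Sum>i\<in>UNIV. \<phi> (e i))"
    by (simp add: L sum_unfold_sum_mset multiset.map_comp comp_def)
  finally show ?thesis .
qed

lemma lam_1_eigensystem:
  assumes "eigensystem M u e"
  shows "lam 1 M = Max (range e)"
proof -
  define L where "L = rev (sorted_list_of_multiset (proots (charpoly M)))"
  have "mset L = image_mset e (mset_set UNIV)"
    using mset_lam_eigensystem[OF assms] by (simp add: L_def)
  then have L: "set L = range e"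
    by (metis finite finite_set_mset_mset_set set_image_mset set_mset_mset)
  have "sorted_wrt (\<ge>) L"
    by (simp add: L_def sorted_wrt_rev)
  then have "Max (set L) = L ! 0"
  proof (cases L)
    case (Cons a K)
    then show ?thesis
      using \<open>sorted_wrt (\<ge>) L\<close> by (intro Max_eqI) auto
  qed (use L in simp)
  then show ?thesis
    by (simp add: lam_def L_def[symmetric] L)
qed

subsection \<open>The trace exponential\<close>

lemma eigensystem_quadratic_form:
  assumes "eigensystem M u e"
  shows "x \<bullet> (M *v x) = (\<Sum>i\<in>UNIV. (u i \<bullet> x)\<^sup>2 * e i)"
proof -
  have M: "transpose M = M" and u: "\<And>i j. u i \<bullet> u j = (if i = j then 1 else 0)"
    and e: "\<And>i. M *v u i = e i *\<^sub>R u i"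
    using assms by (auto simp: eigensystem_def)
  have "x \<bullet> (M *v x) = (\<Sum>i\<in>UNIV. (u i \<bullet> x) * (u i \<bullet> (M *v x)))"
    by (rule orthonormal_family_parseval[OF u, symmetric])
  also have "\<dots> = (\<Sum>i\<in>UNIV. (u i \<bullet> x)\<^sup>2 * e i)"
    by (simp add: symmetric_matrix_inner[OF M] e power2_eq_square mult_ac)
  finally show ?thesis .
qed

text \<open>Peierls' inequality: Jensen for the weights \<open>(v i \<bullet> u a)\<^sup>2\<close>, which form a doubly stochastic matrix.\<close>

lemma sum_convex_diagonal_le_eigenvalues:
  fixes u :: "'n::finite \<Rightarrow> real^'n"
  assumes N: "eigensystem N v d" and \<phi>: "convex_on UNIV \<phi>"
    and u: "\<And>i j. u i \<bullet> u j = (if i = j then 1 else 0)"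
  shows "(\<Sum>a\<in>UNIV. \<phi> (u a \<bullet> (N *v u a))) \<le> (\<Sum>i\<in>UNIV. \<phi> (d i))"
proof -
  have v: "\<And>i j. v i \<bullet> v j = (if i = j then 1 else 0)"
    using N by (auto simp: eigensystem_def)
  have row: "(\<Sum>i\<in>UNIV. (v i \<bullet> u a)\<^sup>2) = 1" for a
    using orthonormal_family_parseval[OF v, of "u a" "u a"] u by (simp add: power2_eq_square)
  have col: "(\<Sum>a\<in>UNIV. (v i \<bullet> u a)\<^sup>2) = 1" for i
    using orthonormal_family_parseval[OF u, of "v i" "v i"] v
    by (simp add: power2_eq_square inner_commute)
  have "(\<Sum>a\<in>UNIV. \<phi> (u a \<bullet> (N *v u a))) = (\<Sum>a\<in>UNIV. \<phi> (\<Sum>i\<in>UNIV. (v i \<bullet> u a)\<^sup>2 *\<^sub>R d i))"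
    by (simp add: eigensystem_quadratic_form[OF N])
  also have "\<dots> \<le> (\<Sum>a\<in>UNIV. \<Sum>i\<in>UNIV. (v i \<bullet> u a)\<^sup>2 * \<phi> (d i))"
    using row by (intro sum_mono convex_on_sum[OF _ _ \<phi>]) auto
  also have "\<dots> = (\<Sum>i\<in>UNIV. (\<Sum>a\<in>UNIV. (v i \<bullet> u a)\<^sup>2) * \<phi> (d i))"
    by (subst sum.swap) (simp add: sum_distrib_right)
  finally show ?thesis by (simp add: col)
qed

text \<open>After division by \<open>exp x\<close> this becomes exp t - 1 - t \<le> t^2 * (exp t +
  1), a consequence of exp t - 1 \<le> t * exp t. Having both exponentials on the right makes it
  valid for all gaps: when each eigenvalue of one matrix is compared with each one of another, gaps
  can be large even for close matrices.\<close>

lemma exp_bregman_le: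
  fixes x y :: real
  shows "exp y \<le> exp x + exp x * (y - x) + (y - x)\<^sup>2 * (exp y + exp x)"
proof -
  define t where "t = y - x"
  have *: "exp t - 1 \<le> t * exp t" for t :: real
    using exp_ge_add_one_self[of "- t"] mult_left_mono[of "1 - t" "exp (- t)" "exp t"]
    by (simp add: exp_minus algebra_simps)
  have "exp t - 1 - t \<le> t * (exp t - 1)"
    using *[of t] by (simp add: algebra_simps)
  also have "\<dots> \<le> t\<^sup>2 * (exp t + 1)"
  proof (cases "t \<ge> 0")
    case True
    have "t * (exp t - 1) \<le> t * (t * exp t)"
      using * True by (rule mult_left_mono)
    then show ?thesis by (simp add: power2_eq_square algebra_simps)
      (use zero_le_square[of t] in linarith)
  next
    case False
    have "(- t) * (1 - exp t) \<le> (- t) * (- t)"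
      using False exp_ge_add_one_self[of t] by (intro mult_left_mono) linarith+
    moreover have "0 \<le> t\<^sup>2 * exp t" by simp
    ultimately show ?thesis by (simp add: power2_eq_square algebra_simps)
  qed
  finally have "exp x * (exp t - 1 - t) \<le> exp x * (t\<^sup>2 * (exp t + 1))"
    by simp
  moreover have "exp y = exp x * exp t"
    by (simp add: t_def flip: exp_add)
  ultimately show ?thesis
    unfolding t_def[symmetric] by (simp add: algebra_simps)
qed

text \<open>A quantitative converse of Klein's inequality. In the two eigenbases, \<open>(u a \<bullet> v i) * (d i - e a)\<close>
  is the matrix entry \<open>u a \<bullet> (N - M) v i\<close>, so the squared eigenvalue gaps that the scalar estimate
  produces sum up to squared norms of \<open>N - M\<close> and no perturbation theory for eigenvalues is needed.\<close>

lemma trace_exp_le: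
  fixes M N :: "real^'n^'n"
  assumes M: "eigensystem M u e" and N: "eigensystem N v d"
    and \<eta>: "\<And>x. norm ((N - M) *v x) \<le> \<eta> * norm x"
  shows "(\<Sum>i\<in>UNIV. exp (d i)) \<le> (\<Sum>a\<in>UNIV. exp (e a)) + (\<Sum>a\<in>UNIV. exp (e a) * (u a \<bullet> ((N - M) *v u a)))
    + \<eta>\<^sup>2 * ((\<Sum>i\<in>UNIV. exp (d i)) + (\<Sum>a\<in>UNIV. exp (e a)))"
proof -
  have Mt: "transpose M = M" and u: "\<And>i j. u i \<bullet> u j = (if i = j then 1 else 0)"
    and e: "\<And>i. M *v u i = e i *\<^sub>R u i"
    using M by (auto simp: eigensystem_def)
  have Nt: "transpose N = N" and v: "\<And>i j. v i \<bullet> v j = (if i = j then 1 else 0)"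
    and d: "\<And>i. N *v v i = d i *\<^sub>R v i"
    using N by (auto simp: eigensystem_def)
  define H where "H = N - M"
  define D where "D a i = (u a \<bullet> v i)\<^sup>2" for a i
  define W where "W a i = (u a \<bullet> (H *v v i))\<^sup>2" for a i
  have Ht: "x \<bullet> (H *v y) = (H *v x) \<bullet> y" for x y
    by (simp add: H_def matrix_vector_mult_diff_rdistrib inner_diff_left inner_diff_right
        symmetric_matrix_inner[OF Mt] symmetric_matrix_inner[OF Nt])
  have bound: "(H *v x) \<bullet> (H *v x) \<le> \<eta>\<^sup>2" if "x \<bullet> x = 1" for x
  proof -
    have "norm (H *v x) \<le> \<eta>"
      using \<eta>[of x] that by (simp add: H_def norm_eq_1[THEN iffD2])
    then show ?thesis
      by (metis norm_ge_zero power2_norm_eq_inner power_mono)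
  qed
  have D1: "(\<Sum>i\<in>UNIV. D a i) = 1" for a
    using orthonormal_family_parseval[OF v, of "u a" "u a"] u
    by (simp add: D_def power2_eq_square inner_commute)
  have D2: "(\<Sum>a\<in>UNIV. D a i) = 1" for i
    using orthonormal_family_parseval[OF u, of "v i" "v i"] v
    by (simp add: D_def power2_eq_square)
  have W1: "(\<Sum>i\<in>UNIV. W a i) \<le> \<eta>\<^sup>2" for a
  proof -
    have "(\<Sum>i\<in>UNIV. W a i) = (H *v u a) \<bullet> (H *v u a)"
      unfolding orthonormal_family_parseval[OF v, of "H *v u a" "H *v u a", symmetric]
      by (simp add: W_def Ht[of "u a"] inner_commute[of "H *v u a"] power2_eq_square)
    then show ?thesis using bound u by simp
  qed
  have W2: "(\<Sum>a\<in>UNIV. W a i) \<le> \<eta>\<^sup>2" for i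
  proof -
    have "(\<Sum>a\<in>UNIV. W a i) = (H *v v i) \<bullet> (H *v v i)"
      unfolding orthonormal_family_parseval[OF u, of "H *v v i" "H *v v i", symmetric]
      by (simp add: W_def power2_eq_square)
    then show ?thesis using bound v by simp
  qed
  have W: "W a i = D a i * (d i - e a)\<^sup>2" for a i
  proof -
    have "u a \<bullet> (H *v v i) = (u a \<bullet> v i) * (d i - e a)"
      by (simp add: H_def matrix_vector_mult_diff_rdistrib inner_diff_right d
          symmetric_matrix_inner[OF Mt] e algebra_simps)
    then show ?thesis by (simp add: W_def D_def power_mult_distrib)
  qed
  \<comment> \<open>Averaged over the overlaps \<open>D\<close>, the linear terms of the scalar
    estimate collapse to the diagonal entry of \<open>H\<close> at \<open>u a\<close>.\<close>
  have DN: "(\<Sum>i\<in>UNIV. D a i * (d i - e a)) = u a \<bullet> (H *v u a)" for a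
  proof -
    have "u a \<bullet> (H *v u a) = u a \<bullet> (N *v u a) - e a"
      using u[of a a] by (simp add: H_def matrix_vector_mult_diff_rdistrib inner_diff_right e)
    also have "u a \<bullet> (N *v u a) = (\<Sum>i\<in>UNIV. D a i * d i)"
      by (simp add: eigensystem_quadratic_form[OF N] D_def inner_commute)
    finally show ?thesis
      using D1[of a] by (simp add: right_diff_distrib sum_subtractf flip: sum_distrib_right)
  qed
  \<comment> \<open>Unit column sums spread each \<open>exp (d i)\<close> over all pairs, so that it
    can be compared with every \<open>e a\<close>.\<close>
  have "(\<Sum>i\<in>UNIV. exp (d i)) = (\<Sum>i\<in>UNIV. (\<Sum>a\<in>UNIV. D a i) * exp (d i))"
    by (simp add: D2)
  also have "\<dots> = (\<Sum>a\<in>UNIV. \<Sum>i\<in>UNIV. D a i * exp (d i))"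
    unfolding sum_distrib_right by (rule sum.swap)
  also have "\<dots> \<le> (\<Sum>a\<in>UNIV. \<Sum>i\<in>UNIV. D a i * (exp (e a) + exp (e a) * (d i - e a)
      + (d i - e a)\<^sup>2 * (exp (d i) + exp (e a))))"
    using exp_bregman_le by (intro sum_mono mult_left_mono) (auto simp: D_def)
  also have "\<dots> = (\<Sum>a\<in>UNIV. \<Sum>i\<in>UNIV. exp (e a) * D a i + exp (e a) * (D a i * (d i - e a))
      + exp (e a) * W a i + exp (d i) * W a i)"
    unfolding W by (intro sum.cong refl) (simp add: algebra_simps)
  also have "\<dots> = (\<Sum>a\<in>UNIV. exp (e a) * (\<Sum>i\<in>UNIV. D a i)) + (\<Sum>a\<in>UNIV. exp (e a) * (\<Sum>i\<in>UNIV. D a i * (d i - e a)))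
      + (\<Sum>a\<in>UNIV. exp (e a) * (\<Sum>i\<in>UNIV. W a i)) + (\<Sum>a\<in>UNIV. \<Sum>i\<in>UNIV. exp (d i) * W a i)"
    by (simp add: sum.distrib sum_distrib_left)
  finally have "(\<Sum>i\<in>UNIV. exp (d i)) \<le> (\<Sum>a\<in>UNIV. exp (e a)) + (\<Sum>a\<in>UNIV. exp (e a) * (u a \<bullet> (H *v u a)))
      + (\<Sum>a\<in>UNIV. exp (e a) * (\<Sum>i\<in>UNIV. W a i)) + (\<Sum>a\<in>UNIV. \<Sum>i\<in>UNIV. exp (d i) * W a i)"
    by (simp only: D1 DN mult_1_right)
  moreover have "(\<Sum>a\<in>UNIV. \<Sum>i\<in>UNIV. exp (d i) * W a i) \<le> (\<Sum>i\<in>UNIV. exp (d i) * \<eta>\<^sup>2)"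
    using W2 by (subst sum.swap) (auto intro!: sum_mono mult_left_mono simp flip: sum_distrib_left)
  moreover have "(\<Sum>a\<in>UNIV. exp (e a) * (\<Sum>i\<in>UNIV. W a i)) \<le> (\<Sum>a\<in>UNIV. exp (e a) * \<eta>\<^sup>2)"
    using W1 by (intro sum_mono mult_left_mono) auto
  ultimately show ?thesis
    unfolding H_def sum_distrib_right[symmetric] distrib_left mult.commute[of "\<eta>\<^sup>2"] by linarith
qed

text \<open>The error in \<open>trace_exp_le\<close> contains the left-hand sum itself. For \<eta>
  \<le> 1/2 the ratio q of the two sums is first bounded by a constant; reinserting that bound
  leaves a multiple of \<eta>^2, and ln q \<le> q - 1 finishes.\<close>

lemma ln_trace_exp_le:
  fixes M N :: "real^'n^'n"
  assumes M: "eigensystem M u e" and N: "eigensystem N v d"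
    and \<eta>: "\<And>x. norm ((N - M) *v x) \<le> \<eta> * norm x" "0 \<le> \<eta>" "\<eta> \<le> 1/2"
  shows "ln (\<Sum>i\<in>UNIV. exp (d i)) \<le> ln (\<Sum>a\<in>UNIV. exp (e a))
    + (\<Sum>a\<in>UNIV. exp (e a) / (\<Sum>a\<in>UNIV. exp (e a)) * (u a \<bullet> ((N - M) *v u a))) + 6 * \<eta>\<^sup>2"
proof -
  define S where "S = (\<Sum>a\<in>UNIV. exp (e a))"
  define T where "T = (\<Sum>i\<in>UNIV. exp (d i))"
  define s where "s a = u a \<bullet> ((N - M) *v u a)" for a
  define \<sigma> where "\<sigma> = (\<Sum>a\<in>UNIV. exp (e a) / S * s a)"
  have pos: "S > 0" "T > 0"
    unfolding S_def T_def by (auto intro!: sum_pos)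
  define q where "q = T / S"
  have u: "norm (u a) = 1" for a
    using M by (simp add: eigensystem_def norm_eq_1)
  have "s a \<le> \<eta>" for a
    using norm_cauchy_schwarz[of "u a" "(N - M) *v u a"] \<eta>(1)[of "u a"] u by (simp add: s_def)
  then have "\<sigma> \<le> (\<Sum>a\<in>UNIV. exp (e a) / S * \<eta>)"
    unfolding \<sigma>_def using pos by (intro sum_mono mult_left_mono) auto
  also have "\<dots> = \<eta>"
    using pos by (simp add: S_def flip: sum_distrib_right sum_divide_distrib)
  finally have "\<sigma> \<le> 1/2" using \<eta>(3) by simp
  have "S * \<sigma> = (\<Sum>a\<in>UNIV. exp (e a) * s a)"
    using pos by (simp add: \<sigma>_def sum_distrib_left)
  then have "T \<le> S + S * \<sigma> + \<eta>\<^sup>2 * (T + S)"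
    using trace_exp_le[OF M N \<eta>(1)] by (simp add: S_def T_def s_def)
  then have "q \<le> (S + S * \<sigma> + \<eta>\<^sup>2 * (T + S)) / S"
    unfolding q_def using pos by (intro divide_right_mono) auto
  then have r: "q \<le> 1 + \<sigma> + \<eta>\<^sup>2 * (q + 1)"
    using pos by (simp add: q_def add_divide_distrib distrib_left)
  have "\<eta>\<^sup>2 \<le> (1/2)\<^sup>2"
    using \<eta> by (intro power_mono) auto
  then have "\<eta>\<^sup>2 * (q + 1) \<le> 1/4 * (q + 1)"
    using pos by (intro mult_right_mono) (auto simp: q_def power2_eq_square)
  \<comment> \<open>The estimate reads q \<le> 3/2 + (q + 1)/4, so q is at most 7/3; the cruder 5 is
    the source of the constant 6.\<close>
  then have "q \<le> 5"
    using r \<open>\<sigma> \<le> 1/2\<close> by argo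
  then have "\<eta>\<^sup>2 * (q + 1) \<le> \<eta>\<^sup>2 * 6"
    by (intro mult_left_mono) auto
  then have "q - 1 \<le> \<sigma> + 6 * \<eta>\<^sup>2"
    using r by simp
  moreover have "ln q \<le> q - 1"
    using pos by (intro ln_le_minus_one) (simp add: q_def)
  moreover have "ln q = ln T - ln S"
    using pos by (simp add: q_def ln_div)
  ultimately show ?thesis
    by (simp add: S_def[symmetric] T_def[symmetric] \<sigma>_def s_def)
qed

lemma ln_trace_exp_ge:
  fixes N :: "real^'n^'n" and u :: "'n \<Rightarrow> real^'n"
  assumes N: "eigensystem N v d" and u: "\<And>i j. u i \<bullet> u j = (if i = j then 1 else 0)"
    and s: "\<And>a. e a + s a \<le> u a \<bullet> (N *v u a)"
  shows "ln (\<Sum>a\<in>UNIV. exp (e a)) + (\<Sum>a\<in>UNIV. exp (e a) / (\<Sum>a\<in>UNIV. exp (e a)) * s a)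
    \<le> ln (\<Sum>i\<in>UNIV. exp (d i))"
proof -
  define S where "S = (\<Sum>a\<in>UNIV. exp (e a))"
  define \<sigma> where "\<sigma> = (\<Sum>a\<in>UNIV. exp (e a) / S * s a)"
  have pos: "S > 0"
    unfolding S_def by (auto intro!: sum_pos)
  have "exp (\<Sum>a\<in>UNIV. (exp (e a) / S) *\<^sub>R s a) \<le> (\<Sum>a\<in>UNIV. exp (e a) / S * exp (s a))"
    using pos by (intro convex_on_sum[OF _ _ exp_convex])
      (auto simp: S_def simp flip: sum_divide_distrib)
  then have "S * exp \<sigma> \<le> S * (\<Sum>a\<in>UNIV. exp (e a) / S * exp (s a))"
    using pos by (intro mult_left_mono) (auto simp: \<sigma>_def)
  also have "\<dots> = (\<Sum>a\<in>UNIV. exp (e a + s a))"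
    using pos by (simp add: sum_distrib_left exp_add)
  also have "\<dots> \<le> (\<Sum>a\<in>UNIV. exp (u a \<bullet> (N *v u a)))"
    using s by (intro sum_mono) auto
  also have "\<dots> \<le> (\<Sum>i\<in>UNIV. exp (d i))"
    by (rule sum_convex_diagonal_le_eigenvalues[OF N exp_convex u])
  finally have "ln (S * exp \<sigma>) \<le> ln (\<Sum>i\<in>UNIV. exp (d i))"
    using pos by (subst ln_le_cancel_iff) (auto intro!: sum_pos)
  then show ?thesis
    using pos by (simp add: ln_mult S_def[symmetric] \<sigma>_def)
qed

subsection \<open>Functions between quadratic bounds\<close>

text \<open>Take the hyperplane at the convex combination z and average its values at x and y: the
  linear terms cancel.\<close>

lemma convex_on_if_supporting_hyperplanes:
  fixes f :: "'a::real_inner \<Rightarrow> real"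
  assumes "convex S" and sub: "\<And>x y. x \<in> S \<Longrightarrow> y \<in> S \<Longrightarrow> f x + g x \<bullet> (y - x) \<le> f y"
  shows "convex_on S f"
proof (rule convex_onI[OF _ \<open>convex S\<close>])
  fix t x y assume t: "0 < t" "t < (1::real)" and xy: "x \<in> S" "y \<in> S"
  define z where "z = (1 - t) *\<^sub>R x + t *\<^sub>R y"
  have "z \<in> S"
    unfolding z_def using \<open>convex S\<close> t xy by (simp add: convex_alt)
  have "(1 - t) * (f z + g z \<bullet> (x - z)) + t * (f z + g z \<bullet> (y - z)) \<le> (1 - t) * f x + t * f y"
    using t sub[OF \<open>z \<in> S\<close>] xy by (intro add_mono mult_left_mono) auto
  moreover have "(1 - t) * (g z \<bullet> (x - z)) + t * (g z \<bullet> (y - z)) = 0"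
  proof -
    have "(1 - t) * (g z \<bullet> (x - z)) + t * (g z \<bullet> (y - z)) = g z \<bullet> ((1 - t) *\<^sub>R (x - z) + t *\<^sub>R (y - z))"
      by (simp add: inner_add_right)
    also have "(1 - t) *\<^sub>R (x - z) + t *\<^sub>R (y - z) = 0"
      by (simp add: z_def algebra_simps)
    finally show ?thesis by simp
  qed
  moreover have "(1 - t) * (f z + g z \<bullet> (x - z)) + t * (f z + g z \<bullet> (y - z))
      = f z + ((1 - t) * (g z \<bullet> (x - z)) + t * (g z \<bullet> (y - z)))"
    by (simp add: algebra_simps)
  ultimately show "f ((1 - t) *\<^sub>R x + t *\<^sub>R y) \<le> (1 - t) * f x + t * f y"
    by (simp add: z_def[symmetric])
qed

lemma GDERIV_if_quadratic_remainder:
  fixes f :: "'a::real_inner \<Rightarrow> real"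
  assumes "r > 0" and rem: "\<And>y. norm (y - x) < r \<Longrightarrow> \<bar>f y - f x - g \<bullet> (y - x)\<bar> \<le> \<beta> * (norm (y - x))\<^sup>2"
  shows "GDERIV f x :> g"
  unfolding gderiv_def has_derivative_within_alt2
proof (intro conjI allI impI)
  show "bounded_linear (\<lambda>h. h \<bullet> g)"
    by (rule bounded_linear_inner_left)
  fix \<epsilon> :: real assume "\<epsilon> > 0"
  \<comment> \<open>The first entry makes the remainder bound available, the second lets \<epsilon>
    absorb one factor \<open>norm (y - x)\<close>.\<close>
  define \<rho> where "\<rho> = min r (\<epsilon> / (\<bar>\<beta>\<bar> + 1))"
  have "\<rho> > 0"
    using \<open>r > 0\<close> \<open>\<epsilon> > 0\<close> by (simp add: \<rho>_def)
  have "norm (f y - f x - (y - x) \<bullet> g) \<le> \<epsilon> * norm (y - x)" if "dist y x < \<rho>" for y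
  proof -
    have y: "norm (y - x) < r" "norm (y - x) \<le> \<epsilon> / (\<bar>\<beta>\<bar> + 1)"
      using that by (auto simp: \<rho>_def dist_norm)
    have "\<beta> * (norm (y - x))\<^sup>2 \<le> (\<bar>\<beta>\<bar> + 1) * (norm (y - x))\<^sup>2"
      by (intro mult_right_mono) auto
    also have "\<dots> = ((\<bar>\<beta>\<bar> + 1) * norm (y - x)) * norm (y - x)"
      by (simp add: power2_eq_square)
    also have "\<dots> \<le> \<epsilon> * norm (y - x)"
      using y(2) by (intro mult_right_mono) (simp_all add: pos_le_divide_eq mult.commute)
    finally show ?thesis
      using rem[OF y(1)] by (simp add: inner_commute)
  qed
  then show "\<forall>\<^sub>F y in at x. norm (f y - f x - (y - x) \<bullet> g) \<le> \<epsilon> * norm (y - x)"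
    unfolding eventually_at using \<open>\<rho> > 0\<close> by blast
qed

text \<open>Cut the segment from x to y into equal pieces shorter than r. Convexity keeps the nodes
  in \<open>S\<close>, and since the lengths add up exactly the constant does not
  deteriorate.\<close>

lemma lipschitz_on_convex_if_locally:
  fixes g :: "'a::real_normed_vector \<Rightarrow> 'b::real_normed_vector"
  assumes "convex S" "r > 0" "0 \<le> L"
    and loc: "\<And>x y. x \<in> S \<Longrightarrow> y \<in> S \<Longrightarrow> norm (y - x) < r \<Longrightarrow> norm (g y - g x) \<le> L * norm (y - x)"
  shows "L-lipschitz_on S g"
proof (rule lipschitz_onI)
  fix x y assume xy: "x \<in> S" "y \<in> S"
  obtain n where n: "norm (y - x) / r < real n"
    using reals_Archimedean2 by blast
  then have "n > 0"
    using \<open>r > 0\<close> by (cases n) (auto simp: divide_less_0_iff)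
  define z where "z k = x + (real k / real n) *\<^sub>R (y - x)" for k
  have z: "z k \<in> S" if "k \<le> n" for k
  proof -
    have "z k = (1 - real k / real n) *\<^sub>R x + (real k / real n) *\<^sub>R y"
      by (simp add: z_def algebra_simps)
    then show ?thesis
      using \<open>convex S\<close> xy that \<open>n > 0\<close> by (simp add: convex_alt)
  qed
  have diff: "norm (z (Suc k) - z k) = norm (y - x) / real n" for k
  proof -
    have "z (Suc k) - z k = (1 / real n) *\<^sub>R (y - x)"
      by (simp add: z_def add_divide_distrib algebra_simps)
    then show ?thesis by simp
  qed
  have "norm (g y - g x) = norm (g (z n) - g (z 0))"
    using \<open>n > 0\<close> by (simp add: z_def)
  also have "\<dots> = norm (\<Sum>k<n. g (z (Suc k)) - g (z k))"
    by (simp only: sum_lessThan_telescope[of "\<lambda>k. g (z k)"])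
  also have "\<dots> \<le> (\<Sum>k<n. L * (norm (y - x) / real n))"
  proof (rule sum_norm_le)
    fix k assume "k \<in> {..<n}"
    moreover have "norm (y - x) / real n < r"
      using n \<open>n > 0\<close> \<open>r > 0\<close> by (simp add: field_simps)
    ultimately show "norm (g (z (Suc k)) - g (z k)) \<le> L * (norm (y - x) / real n)"
      using loc[of "z k" "z (Suc k)"] z diff by simp
  qed
  also have "\<dots> = L * norm (y - x)"
    using \<open>n > 0\<close> by simp
  finally show "dist (g x) (g y) \<le> L * dist x y"
    by (simp add: dist_norm norm_minus_commute)
qed fact

text \<open>Stepping from \<open>y\<close> by \<open>norm (y - x)\<close> against \<open>g y - g x\<close> must not push \<open>f\<close>
  below its supporting hyperplane at \<open>x\<close>.\<close>

lemma lipschitz_on_gradient_if_quadratic_bounds: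
  fixes f :: "'a::real_inner \<Rightarrow> real"
  assumes "convex S" "r > 0" "0 \<le> \<beta>"
    and U: "\<And>x y. x \<in> S \<Longrightarrow> norm (y - x) < r \<Longrightarrow> y \<in> U"
    and lower: "\<And>x y. x \<in> U \<Longrightarrow> y \<in> U \<Longrightarrow> f x + g x \<bullet> (y - x) \<le> f y"
    and upper: "\<And>x y. x \<in> U \<Longrightarrow> y \<in> U \<Longrightarrow> norm (y - x) < r \<Longrightarrow>
      f y \<le> f x + g x \<bullet> (y - x) + \<beta> * (norm (y - x))\<^sup>2"
  shows "(2 * \<beta>)-lipschitz_on S g"
proof (rule lipschitz_on_convex_if_locally[OF \<open>convex S\<close> \<open>r > 0\<close>])
  fix x y assume xy: "x \<in> S" "y \<in> S" "norm (y - x) < r"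
  define s where "s = norm (y - x)"
  define d where "d = g y - g x"
  show "norm (g y - g x) \<le> 2 * \<beta> * norm (y - x)"
  proof (cases "x = y \<or> d = 0")
    case True
    then show ?thesis using \<open>0 \<le> \<beta>\<close> by (auto simp: d_def)
  next
    case False
    then have "s > 0" "norm d > 0" by (auto simp: s_def)
    define z where "z = y - (s / norm d) *\<^sub>R d"
    have zy: "norm (z - y) = s"
      using \<open>s > 0\<close> \<open>norm d > 0\<close> by (simp add: z_def)
    \<comment> \<open>z may leave \<open>S\<close>, which is why the bounds are required on
      \<open>U\<close>; its distance s from y is below r, so it stays in \<open>U\<close>.\<close>
    have in_U: "x \<in> U" "y \<in> U" "z \<in> U"
      using U xy zy s_def \<open>r > 0\<close> by (auto intro: U[of x x] U[of x y] U[of y z])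
    have "f x + g x \<bullet> (z - x) \<le> f z"
      using lower in_U by blast
    also have "f z \<le> f y + g y \<bullet> (z - y) + \<beta> * s\<^sup>2"
      using upper[of y z] in_U zy xy s_def by simp
    also have "f y \<le> f x + g x \<bullet> (y - x) + \<beta> * s\<^sup>2"
      using upper[of x y] in_U xy s_def by simp
    finally have "0 \<le> d \<bullet> (z - y) + 2 * \<beta> * s\<^sup>2"
      by (simp add: d_def inner_diff_left inner_diff_right)
    moreover have "d \<bullet> (z - y) = - (s * norm d)"
      using \<open>norm d > 0\<close> by (simp add: z_def power2_norm_eq_inner[symmetric] power2_eq_square)
    ultimately have "s * norm d \<le> s * (2 * \<beta> * s)"
      by (simp add: power2_eq_square mult_ac)
    then show ?thesis
      using \<open>s > 0\<close> by (simp add: s_def d_def)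
  qed
qed (use \<open>0 \<le> \<beta>\<close> in simp)

subsection \<open>Scaled log-sum-exp\<close>

text \<open>Power means increase with the exponent: Jensen for the power p = \<nu> / \<mu> \<ge> 1
  with uniform weights, applied to \<open>exp (e i / \<nu>)\<close>.\<close>

lemma ln_mean_exp_antimono:
  fixes e :: "'n::finite \<Rightarrow> real"
  assumes "0 < \<mu>" "\<mu> \<le> \<nu>"
  shows "\<nu> * ln ((\<Sum>i\<in>UNIV. exp (e i / \<nu>)) / real CARD('n)) \<le> \<mu> * ln ((\<Sum>i\<in>UNIV. exp (e i / \<mu>)) / real CARD('n))"
proof -
  let ?n = "real CARD('n)"
  define p where "p = \<nu> / \<mu>"
  have "p \<ge> 1" and p: "\<nu> = \<mu> * p"
    using assms by (auto simp: p_def)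
  define m where "m = (\<Sum>i\<in>UNIV. (1 / ?n) *\<^sub>R exp (e i / \<nu>))"
  have "m > 0"
    unfolding m_def by (intro sum_pos) auto
  have "exp (e i / \<nu>) powr p = exp (e i / \<mu>)" for i
    using assms by (simp add: exp_powr_real p_def)
  then have "m powr p \<le> (\<Sum>i\<in>UNIV. 1 / ?n * exp (e i / \<mu>))"
    unfolding m_def using convex_on_sum[OF _ _ powr_convex[OF \<open>p \<ge> 1\<close>],
        of UNIV "\<lambda>_. 1 / ?n" "\<lambda>i. exp (e i / \<nu>)"]
    by (auto simp: card_gt_0_iff)
  then have "ln (m powr p) \<le> ln (\<Sum>i\<in>UNIV. 1 / ?n * exp (e i / \<mu>))"
    using \<open>m > 0\<close> by (subst ln_le_cancel_iff) (auto intro!: sum_pos)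
  then have "\<mu> * (p * ln m) \<le> \<mu> * ln (\<Sum>i\<in>UNIV. 1 / ?n * exp (e i / \<mu>))"
    using assms \<open>m > 0\<close> by (intro mult_left_mono) (auto simp: ln_powr)
  then show ?thesis
    unfolding p by (simp add: m_def mult.assoc sum_divide_distrib p)
qed

text \<open>The p-norm is at most the 1-norm: once the terms are normalised to sum 1, each
  \<open>w i\<close> is at most 1 and thus dominates its p-th power.\<close>

lemma ln_sum_exp_mono:
  fixes e :: "'n::finite \<Rightarrow> real"
  assumes "0 < \<mu>" "\<mu> \<le> \<nu>"
  shows "\<mu> * ln (\<Sum>i\<in>UNIV. exp (e i / \<mu>)) \<le> \<nu> * ln (\<Sum>i\<in>UNIV. exp (e i / \<nu>))"
proof -
  define p where "p = \<nu> / \<mu>"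
  have "p \<ge> 1" and p: "\<nu> = \<mu> * p"
    using assms by (auto simp: p_def)
  define S where "S = (\<Sum>i\<in>UNIV. exp (e i / \<nu>))"
  define w where "w i = exp (e i / \<nu>) / S" for i
  have S: "S > 0"
    unfolding S_def by (auto intro!: sum_pos)
  have w: "0 < w i" "w i \<le> 1" for i
    using S by (auto simp: w_def S_def intro!: member_le_sum)
  have "exp (e i / \<mu>) = (S * w i) powr p" for i
    using assms S by (simp add: w_def exp_powr_real p_def)
  also have "(S * w i) powr p = S powr p * w i powr p" for i
    using S w[of i] by (simp add: powr_mult)
  also have "S powr p * w i powr p \<le> S powr p * w i" for i
    using powr_mono'[of 1 p "w i"] \<open>p \<ge> 1\<close> w[of i] by (intro mult_left_mono) auto
  finally have "(\<Sum>i\<in>UNIV. exp (e i / \<mu>)) \<le> (\<Sum>i\<in>UNIV. S powr p * w i)"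
    by (intro sum_mono)
  also have "\<dots> = S powr p"
    using S by (simp add: w_def S_def flip: sum_distrib_left sum_divide_distrib)
  finally have "ln (\<Sum>i\<in>UNIV. exp (e i / \<mu>)) \<le> ln (S powr p)"
    using S by (subst ln_le_cancel_iff) (auto intro!: sum_pos)
  then have "\<mu> * ln (\<Sum>i\<in>UNIV. exp (e i / \<mu>)) \<le> \<mu> * (p * ln S)"
    using assms S by (intro mult_left_mono) (auto simp: ln_powr)
  then show ?thesis
    unfolding S_def p by (simp add: mult.assoc)
qed

text \<open>The sum lies between its largest term and \<open>CARD('n)\<close> times that term. This
  serves the parameter 0, where the smoothed function is the largest eigenvalue.\<close>

lemma ln_sum_exp_Max_bounds:
  fixes e :: "'n::finite \<Rightarrow> real"
  assumes "0 < \<mu>"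
  shows "Max (range e) \<le> \<mu> * ln (\<Sum>i\<in>UNIV. exp (e i / \<mu>))"
    and "\<mu> * ln (\<Sum>i\<in>UNIV. exp (e i / \<mu>)) \<le> Max (range e) + \<mu> * ln (real CARD('n))"
proof -
  let ?S = "\<Sum>i\<in>UNIV. exp (e i / \<mu>)"
  have S: "?S > 0"
    by (auto intro!: sum_pos)
  obtain k where k: "Max (range e) = e k"
    using Max_in[of "range e"] by (auto simp only: finite_imageI finite empty_is_image UNIV_not_empty)
  have "exp (e k / \<mu>) \<le> ?S"
    by (intro member_le_sum) auto
  then have "e k / \<mu> \<le> ln ?S"
    using S by (simp add: ln_ge_iff)
  then show "Max (range e) \<le> \<mu> * ln ?S"
    using assms by (simp add: k pos_divide_le_eq mult.commute)
  have "e i \<le> e k" for i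
    unfolding k[symmetric] by simp
  then have "?S \<le> (\<Sum>i\<in>(UNIV :: 'n set). exp (e k / \<mu>))"
    using assms by (intro sum_mono) (simp add: divide_right_mono)
  then have "ln ?S \<le> ln (real CARD('n) * exp (e k / \<mu>))"
    using S by (subst ln_le_cancel_iff) auto
  also have "\<dots> = ln (real CARD('n)) + e k / \<mu>"
    by (simp add: ln_mult)
  finally have "\<mu> * ln ?S \<le> \<mu> * (ln (real CARD('n)) + e k / \<mu>)"
    using assms by (intro mult_left_mono) auto
  then show "\<mu> * ln ?S \<le> Max (range e) + \<mu> * ln (real CARD('n))"
    using assms by (simp add: k algebra_simps)
qed

subsection \<open>Feasible set and stiffness matrices\<close>

text \<open>All terms \<open>l $ i * x $ i\<close> are nonnegative, so each one alone is at most
  \<open>V0\<close>; this bounds every coordinate from above.\<close>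

lemma compact_feasible:
  fixes l :: "real^'m"
  assumes l: "\<And>j. 0 < l $ j" and "0 < xmin"
  shows "compact (feasible l V0 xmin)"
proof -
  have "feasible l V0 xmin \<subseteq> cbox (\<chi> j. xmin) (\<chi> j. V0 / l $ j)"
  proof
    fix x assume x: "x \<in> feasible l V0 xmin"
    have "x $ j \<le> V0 / l $ j" for j
    proof -
      have "0 \<le> x $ i" for i
        using x \<open>0 < xmin\<close> by (auto simp: feasible_def intro: order.trans[of _ xmin])
      then have "l $ j * x $ j \<le> (\<Sum>i\<in>UNIV. l $ i * x $ i)"
        using l by (intro member_le_sum) (auto simp: less_imp_le)
      also have "\<dots> \<le> V0"
        using x by (simp add: feasible_def inner_vec_def)
      finally show ?thesis
        using l[of j] by (simp add: pos_le_divide_eq mult.commute)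
    qed
    then show "x \<in> cbox (\<chi> j. xmin) (\<chi> j. V0 / l $ j)"
      using x by (simp add: feasible_def mem_box_cart)
  qed
  moreover have "closed (feasible l V0 xmin)"
    unfolding feasible_def
    by (intro closed_Collect_conj closed_Collect_all closed_Collect_le continuous_intros)
  ultimately show ?thesis
    by (meson bounded_cbox bounded_subset compact_eq_bounded_closed)
qed

lemma convex_feasible: "convex (feasible l V0 xmin)"
proof -
  have "feasible l V0 xmin = {x. l \<bullet> x \<le> V0} \<inter> (\<Inter>j. {x. axis j 1 \<bullet> x \<ge> xmin})"
    by (auto simp: feasible_def inner_axis')
  also have "convex \<dots>"
    by (intro convex_Int convex_INT convex_halfspace_le convex_halfspace_ge)
  finally show ?thesis .
qed

section \<open>Inverses of positive definite matrices and their perturbation\<close>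

lemma pos_def_matrix_inv:
  assumes "pos_def K"
  shows "K ** matrix_inv K = mat 1" "matrix_inv K ** K = mat 1"
proof -
  have "v = 0" if "K *v v = 0" for v
    using assms that by (metis inner_zero_right less_irrefl pos_def_def)
  then have "invertible K"
    by (metis invertible_left_inverse matrix_left_invertible_ker)
  then have "K ** matrix_inv K = mat 1 \<and> matrix_inv K ** K = mat 1"
    unfolding invertible_def matrix_inv_def by (rule someI_ex)
  then show "K ** matrix_inv K = mat 1" "matrix_inv K ** K = mat 1"
    by auto
qed

lemma transpose_matrix_inv_pos_def:
  assumes "pos_def K"
  shows "transpose (matrix_inv K) = matrix_inv K"
proof -
  have "transpose (matrix_inv K) = (matrix_inv K ** K) ** transpose (matrix_inv K)"
    by (simp add: pos_def_matrix_inv(2)[OF assms])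
  also have "\<dots> = matrix_inv K ** transpose (matrix_inv K ** K)"
    using assms by (simp add: matrix_transpose_mul matrix_mul_assoc pos_def_def)
  finally show ?thesis
    by (simp add: pos_def_matrix_inv(2)[OF assms] transpose_mat)
qed

text \<open>Cauchy-Schwarz applied to the coercivity estimate. It bounds the solution of a linear
  system without mentioning a norm of the inverse.\<close>

lemma norm_le_if_coercive:
  fixes K :: "real^'d^'d"
  assumes "c > 0" "c * (norm v)\<^sup>2 \<le> v \<bullet> (K *v v)"
  shows "norm v \<le> norm (K *v v) / c"
proof (cases "v = 0")
  case False
  have "norm v * (c * norm v) \<le> norm v * norm (K *v v)"
    using assms(2) norm_cauchy_schwarz[of v "K *v v"] by (simp add: power2_eq_square mult_ac)
  then show ?thesis
    using False \<open>c > 0\<close> by (simp add: pos_le_divide_eq mult.commute)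
qed (use \<open>c > 0\<close> in simp)

text \<open>The first-order remainder of \<open>w \<bullet> (K\<^sup>-\<^sup>1 w)\<close> at \<open>K\<close> in direction \<open>M - K\<close> is exactly the
  quadratic form \<open>(y - z) \<bullet> (M *v (y - z))\<close>, with \<open>z\<close> and \<open>y\<close> the solutions for \<open>K\<close> and \<open>M\<close>.\<close>

lemma inverse_form_perturbation:
  fixes K M :: "real^'d^'d" and w :: "real^'d"
  assumes K: "pos_def K" and M: "pos_def M"
    and c: "c > 0" "\<And>v. c * (norm v)\<^sup>2 \<le> v \<bullet> (K *v v)" "\<And>v. c * (norm v)\<^sup>2 \<le> v \<bullet> (M *v v)"
    and \<eta>: "0 \<le> \<eta>" "\<And>v. norm ((M - K) *v v) \<le> \<eta> * norm v"
  defines "z \<equiv> matrix_inv K *v w" and "y \<equiv> matrix_inv M *v w"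
  shows "norm (y - z) \<le> \<eta> / c\<^sup>2 * norm w"
    and "w \<bullet> z - z \<bullet> ((M - K) *v z) \<le> w \<bullet> y"
    and "w \<bullet> y \<le> w \<bullet> z - z \<bullet> ((M - K) *v z) + \<eta>\<^sup>2 / c ^ 3 * (norm w)\<^sup>2"
proof -
  have Kz: "K *v z = w"
    by (simp add: z_def matrix_vector_mul_assoc pos_def_matrix_inv(1)[OF K])
  have My: "M *v y = w"
    by (simp add: y_def matrix_vector_mul_assoc pos_def_matrix_inv(1)[OF M])
  have Myz: "M *v (y - z) = - ((M - K) *v z)"
    by (simp add: matrix_vector_mult_diff_distrib matrix_vector_mult_diff_rdistrib Kz My)
  have z: "norm z \<le> norm w / c"
    using norm_le_if_coercive[OF c(1) c(2)[of z]] by (simp add: Kz)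
  have "norm (y - z) \<le> norm ((M - K) *v z) / c"
    using norm_le_if_coercive[OF c(1) c(3)[of "y - z"]] by (simp add: Myz)
  also have Hz: "norm ((M - K) *v z) \<le> \<eta> * (norm w / c)"
    using \<eta>(2)[of z] mult_left_mono[OF z \<eta>(1)] by linarith
  finally show yz: "norm (y - z) \<le> \<eta> / c\<^sup>2 * norm w"
    using c(1) by (simp add: divide_right_mono power2_eq_square)
  have "z \<bullet> (M *v y) = y \<bullet> (M *v z)"
    using M by (metis dot_lmul_matrix inner_commute pos_def_def transpose_matrix_vector)
  \<comment> \<open>Expand the last form with M y = w and K z = w; the symmetry of \<open>M\<close>
    merges the two cross terms into \<open>2 * (w \<bullet> z)\<close>.\<close>
  then have eq: "w \<bullet> y = w \<bullet> z - z \<bullet> ((M - K) *v z) + (y - z) \<bullet> (M *v (y - z))"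
    by (simp add: matrix_vector_mult_diff_distrib matrix_vector_mult_diff_rdistrib Kz My
        inner_diff_left inner_diff_right inner_commute)
  have "0 \<le> (y - z) \<bullet> (M *v (y - z))"
    using c(1) c(3)[of "y - z"] by (meson less_imp_le mult_nonneg_nonneg order.trans zero_le_power2)
  then show "w \<bullet> z - z \<bullet> ((M - K) *v z) \<le> w \<bullet> y"
    using eq by linarith
  \<comment> \<open>Both factors are of first order in \<eta>, so the remainder is quadratic in
    it.\<close>
  have "(y - z) \<bullet> (M *v (y - z)) \<le> norm (y - z) * norm ((M - K) *v z)"
    using norm_cauchy_schwarz[of "y - z" "M *v (y - z)"] by (simp add: Myz)
  also have "\<dots> \<le> (\<eta> / c\<^sup>2 * norm w) * (\<eta> * (norm w / c))"
    using yz Hz c(1) \<eta>(1) by (intro mult_mono) auto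
  also have "\<dots> = \<eta>\<^sup>2 / c ^ 3 * (norm w)\<^sup>2"
    by (simp add: power2_eq_square power3_eq_cube)
  finally show "w \<bullet> y \<le> w \<bullet> z - z \<bullet> ((M - K) *v z) + \<eta>\<^sup>2 / c ^ 3 * (norm w)\<^sup>2"
    using eq by linarith
qed

section \<open>Uniform bounds for the stiffness matrices\<close>

lemma stiffness_mult: "stiffness Ks x *v v = (\<Sum>j\<in>UNIV. x $ j *\<^sub>R (Ks j *v v))"
proof -
  have "(\<Sum>j\<in>A. x $ j *\<^sub>R Ks j) *v v = (\<Sum>j\<in>A. x $ j *\<^sub>R (Ks j *v v))" if "finite A" for A
    using that by induction
      (auto simp: matrix_vector_mult_add_rdistrib scaleR_matrix_vector_assoc [symmetric])
  then show ?thesis by (simp add: stiffness_def)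
qed

lemma stiffness_diff: "stiffness Ks y - stiffness Ks x = stiffness Ks (y - x)"
  by (simp add: stiffness_def scaleR_diff_left sum_subtractf)

lemma norm_stiffness_mult_le:
  obtains k where "k \<ge> 0" "\<And>x v. norm (stiffness Ks x *v v) \<le> k * norm x * norm v"
proof
  show "(\<Sum>j\<in>UNIV. onorm ((*v) (Ks j))) \<ge> 0"
    by (intro sum_nonneg onorm_pos_le) auto
  fix x v
  have "norm (stiffness Ks x *v v) \<le> (\<Sum>j\<in>UNIV. onorm ((*v) (Ks j)) * norm x * norm v)"
    unfolding stiffness_mult
  proof (rule sum_norm_le)
    fix j
    have "norm (x $ j *\<^sub>R (Ks j *v v)) \<le> norm x * (onorm ((*v) (Ks j)) * norm v)"
      using component_le_norm_cart[of x j] by (auto intro!: mult_mono onorm)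
    then show "norm (x $ j *\<^sub>R (Ks j *v v)) \<le> onorm ((*v) (Ks j)) * norm x * norm v"
      by (simp add: mult_ac)
  qed
  then show "norm (stiffness Ks x *v v) \<le> (\<Sum>j\<in>UNIV. onorm ((*v) (Ks j))) * norm x * norm v"
    by (simp add: sum_distrib_right)
qed

text \<open>As every \<open>Ks j\<close> is positive semidefinite, the form grows with each
  coordinate of x, so the constant vector \<delta> is the worst case. The minimum of its form over
  the unit sphere serves all x.\<close>

lemma stiffness_coercive:
  fixes Ks :: "'m::finite \<Rightarrow> real^'d^'d"
  assumes psd: "\<And>j. psd (Ks j)" and pd: "pos_def (stiffness Ks (\<chi> j. \<delta>))"
  obtains c where "c > 0" "\<And>x v. (\<And>j. \<delta> \<le> x $ j) \<Longrightarrow> c * (norm v)\<^sup>2 \<le> v \<bullet> (stiffness Ks x *v v)"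
proof -
  define q where "q v = v \<bullet> (stiffness Ks (\<chi> j. \<delta>) *v v)" for v
  have "continuous_on (sphere 0 1) q"
    unfolding q_def by (intro continuous_intros linear_continuous_on) auto
  then obtain v0 where v0: "v0 \<in> sphere 0 1" "\<And>v. v \<in> sphere 0 1 \<Longrightarrow> q v0 \<le> q v"
    using continuous_attains_inf[of "sphere 0 1" q] by auto
  show thesis
  proof
    show "q v0 > 0"
      using v0(1) pd unfolding q_def pos_def_def by (metis mem_sphere_0 norm_zero zero_neq_one)
    fix x :: "real^'m" and v :: "real^'d" assume x: "\<And>j. \<delta> \<le> x $ j"
    have "q v0 * (norm v)\<^sup>2 \<le> q v"
    proof (cases "v = 0")
      case False
      then have "q v0 \<le> q ((1 / norm v) *\<^sub>R v)"
        by (intro v0(2)) simp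
      also have "\<dots> = q v / (norm v)\<^sup>2"
        by (simp add: q_def matrix_vector_mult_scaleR power2_eq_square)
      finally show ?thesis
        using False by (simp add: pos_le_divide_eq)
    qed (simp add: q_def)
    also have "q v \<le> v \<bullet> (stiffness Ks x *v v)"
      unfolding q_def stiffness_mult inner_sum_right inner_scaleR_right
      using x psd by (intro sum_mono mult_right_mono) (auto simp: psd_def)
    finally show "q v0 * (norm v)\<^sup>2 \<le> v \<bullet> (stiffness Ks x *v v)" .
  qed
qed

subsection \<open>The smoothed compliance\<close>

lemma eigensystem_scaleR:
  assumes "eigensystem M u e"
  shows "eigensystem (c *\<^sub>R M) u (\<lambda>i. c * e i)"
  using assms by (simp add: eigensystem_def transpose_scalar scaleR_matrix_vector_assoc [symmetric])

lemma compliance_inner: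
  "v \<bullet> (compliance Ks Q x *v w) = (Q *v v) \<bullet> (matrix_inv (stiffness Ks x) *v (Q *v w))"
  unfolding compliance_def
  by (metis dot_lmul_matrix inner_commute matrix_vector_mul_assoc transpose_matrix_vector)

lemma transpose_compliance:
  assumes "pos_def (stiffness Ks x)"
  shows "transpose (compliance Ks Q x) = compliance Ks Q x"
  by (simp add: compliance_def matrix_transpose_mul transpose_matrix_inv_pos_def[OF assms] matrix_mul_assoc)

lemma smoothed_eigensystem:
  fixes Q :: "real^'n^'d"
  assumes "eigensystem (compliance Ks Q x) u e"
  shows "smoothed Ks Q \<mu> x = (if \<mu> = 0 then Max (range e)
    else \<mu> * ln (\<Sum>i\<in>UNIV. exp (e i / \<mu>)) - \<mu> * ln (real CARD('n)))"
  unfolding smoothed_def lam_1_eigensystem[OF assms]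
    sum_lam_eigensystem[OF assms, of "\<lambda>s. exp (s / \<mu>)"] ..

text \<open>At a fixed x both bounds concern one family of eigenvalues. For positive parameters the
  lower bound is the power mean inequality and the upper one the p-norm inequality, with the
  normalising terms leaving \<open>ln (real CARD('n))\<close> times the parameter gap.\<close>

lemma smoothed_diff_bounds:
  fixes Q :: "real^'n^'d"
  assumes "pos_def (stiffness Ks x)" and \<mu>: "0 \<le> \<mu>" "\<mu> \<le> \<nu>"
  shows "0 \<le> smoothed Ks Q \<mu> x - smoothed Ks Q \<nu> x"
    and "smoothed Ks Q \<mu> x - smoothed Ks Q \<nu> x \<le> ln (real CARD('n)) * (\<nu> - \<mu>)"
proof -
  obtain u e where ue: "eigensystem (compliance Ks Q x) u e"
    using symmetric_eigensystem_exists[OF transpose_compliance[OF assms(1)]] by blast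
  let ?S = "\<lambda>\<mu>. \<Sum>i\<in>UNIV. exp (e i / \<mu>)"
  note eq = smoothed_eigensystem[OF ue]
  consider "\<nu> = 0" "\<mu> = 0" | "\<mu> = 0" "\<nu> > 0" | "\<mu> > 0" "\<nu> > 0"
    using \<mu> by linarith
  then have "0 \<le> smoothed Ks Q \<mu> x - smoothed Ks Q \<nu> x \<and>
      smoothed Ks Q \<mu> x - smoothed Ks Q \<nu> x \<le> ln (real CARD('n)) * (\<nu> - \<mu>)"
  proof cases
    case 2
    then show ?thesis
      using ln_sum_exp_Max_bounds[of \<nu> e] by (simp add: eq algebra_simps)
  next
    case 3
    have ln: "ln (?S \<mu> / real CARD('n)) = ln (?S \<mu>) - ln (real CARD('n))" for \<mu>
      by (simp add: ln_div sum_nonneg_eq_0_iff)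
    have "\<nu> * (ln (?S \<nu>) - ln (real CARD('n))) \<le> \<mu> * (ln (?S \<mu>) - ln (real CARD('n)))"
      using ln_mean_exp_antimono[OF 3(1) \<mu>(2), of e] by (simp only: ln)
    moreover have "\<mu> * ln (?S \<mu>) \<le> \<nu> * ln (?S \<nu>)"
      by (rule ln_sum_exp_mono[OF 3(1) \<mu>(2)])
    ultimately show ?thesis
      using 3 by (simp add: eq algebra_simps)
  qed simp
  then show "0 \<le> smoothed Ks Q \<mu> x - smoothed Ks Q \<nu> x"
    and "smoothed Ks Q \<mu> x - smoothed Ks Q \<nu> x \<le> ln (real CARD('n)) * (\<nu> - \<mu>)"
    by auto
qed

text \<open>The \<open>a\<close>-th summand is the gradient at \<open>x\<close> of \<open>u a \<bullet> (compliance Ks Q x *v u a)\<close>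
  for the frozen eigenvector \<open>u a\<close>, weighted by the softmax of the eigenvalues.\<close>

definition smoothed_grad ::
    "('m \<Rightarrow> real^'d^'d) \<Rightarrow> real^'n^'d \<Rightarrow> real \<Rightarrow> real^'m \<Rightarrow> ('n \<Rightarrow> real^'n) \<Rightarrow> ('n \<Rightarrow> real) \<Rightarrow> real^'m" where
  "smoothed_grad Ks Q \<mu> x u e =
    (\<chi> j. \<Sum>a\<in>UNIV. exp (e a / \<mu>) / (\<Sum>a\<in>UNIV. exp (e a / \<mu>)) *
      - (let z = matrix_inv (stiffness Ks x) *v (Q *v u a) in z \<bullet> (Ks j *v z)))"

text \<open>Linearity assembles the coordinates into \<open>stiffness Ks h\<close>, the shape of the
  first-order term in \<open>inverse_form_perturbation\<close>.\<close>

lemma smoothed_grad_inner: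
  "smoothed_grad Ks Q \<mu> x u e \<bullet> h =
    (\<Sum>a\<in>UNIV. exp (e a / \<mu>) / (\<Sum>a\<in>UNIV. exp (e a / \<mu>)) *
      - (let z = matrix_inv (stiffness Ks x) *v (Q *v u a) in z \<bullet> (stiffness Ks h *v z)))"
proof -
  have "smoothed_grad Ks Q \<mu> x u e \<bullet> h =
    (\<Sum>j\<in>UNIV. \<Sum>a\<in>UNIV. exp (e a / \<mu>) / (\<Sum>a\<in>UNIV. exp (e a / \<mu>)) *
      - (h $ j * (let z = matrix_inv (stiffness Ks x) *v (Q *v u a) in z \<bullet> (Ks j *v z))))"
    by (simp add: inner_vec_def smoothed_grad_def sum_distrib_left sum_distrib_right mult_ac)
  also have "\<dots> = (\<Sum>a\<in>UNIV. \<Sum>j\<in>UNIV. exp (e a / \<mu>) / (\<Sum>a\<in>UNIV. exp (e a / \<mu>)) *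
      - (h $ j * (let z = matrix_inv (stiffness Ks x) *v (Q *v u a) in z \<bullet> (Ks j *v z))))"
    by (rule sum.swap)
  finally show ?thesis
    by (simp add: stiffness_mult inner_sum_right Let_def sum_distrib_left sum_negf)
qed

theorem proposition1:
  fixes Ks :: "'m::finite \<Rightarrow> real^'d^'d"
    and Q :: "real^'n^'d"
    and l :: "real^'m"
    and V0 xmin :: real
  assumes "\<And>j. psd (Ks j)"
    and "\<And>x. (\<forall>j. 0 < x $ j) \<Longrightarrow> pos_def (stiffness Ks x)"
    and "\<And>j. 0 < l $ j"
    and "0 < V0" and "0 < xmin"
  shows "compact (feasible l V0 xmin)
    \<and> (\<forall>\<mu>>0. convex_on (feasible l V0 xmin) (smoothed Ks Q \<mu>))
    \<and> (\<exists>L>0. \<exists>L'>0. \<forall>\<mu>>0. \<exists>g.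
          (\<forall>x\<in>feasible l V0 xmin. GDERIV (smoothed Ks Q \<mu>) x :> g x) \<and>
          (L' + L / \<mu>)-lipschitz_on (feasible l V0 xmin) g)
    \<and> (\<forall>x\<in>feasible l V0 xmin. \<forall>\<mu>1 \<mu>2. \<mu>1 \<ge> \<mu>2 \<and> \<mu>2 \<ge> 0 \<longrightarrow>
          0 \<le> smoothed Ks Q \<mu>2 x - smoothed Ks Q \<mu>1 x \<and>
          smoothed Ks Q \<mu>2 x - smoothed Ks Q \<mu>1 x
            \<le> ln (real CARD('n)) * (\<mu>1 - \<mu>2))"
proof -
  let ?S = "feasible l V0 xmin"
  let ?A = "compliance Ks Q"
  \<comment> \<open>Halving the lower bound gives a neighbourhood of the feasible set on which the
    stiffness matrices are still uniformly coercive; gradients at boundary points require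
    it.\<close>
  define U where "U = {x :: real^'m. \<forall>j. xmin / 2 \<le> x $ j}"
  have pd: "pos_def (stiffness Ks x)" if "x \<in> U" for x
    using that \<open>0 < xmin\<close> assms(2)[of x] by (force simp: U_def intro: less_le_trans[of 0 "xmin / 2"])
  have S_U: "?S \<subseteq> U"
  proof
    fix x assume "x \<in> ?S"
    then have "xmin / 2 \<le> x $ j" for j
      using \<open>0 < xmin\<close> by (intro order.trans[of "xmin / 2" xmin "x $ j"]) (auto simp: feasible_def)
    then show "x \<in> U" by (simp add: U_def)
  qed
  obtain c where c: "c > 0" "\<And>x v. x \<in> U \<Longrightarrow> c * (norm v)\<^sup>2 \<le> v \<bullet> (stiffness Ks x *v v)"
    using stiffness_coercive[OF assms(1) pd[of "\<chi> j. xmin / 2"]] unfolding U_def by auto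
  obtain k where k: "k \<ge> 0" "\<And>x v. norm (stiffness Ks x *v v) \<le> k * norm x * norm v"
    using norm_stiffness_mult_le by blast
  define q where "q = onorm ((*v) Q)"
  have q: "norm (Q *v v) \<le> q * norm v" for v
    unfolding q_def by (intro onorm) auto
  have "q \<ge> 0"
    unfolding q_def by (intro onorm_pos_le) auto
  \<comment> \<open>\<open>C1\<close> will be a Lipschitz constant of the compliance matrix,
    \<open>C2\<close> the quadratic error constant of its diagonal entries in a frozen basis;
    neither involves \<mu>.\<close>
  define C1 where "C1 = q\<^sup>2 * k / c\<^sup>2"
  define C2 where "C2 = k\<^sup>2 / c ^ 3 * q\<^sup>2"
  have C: "C1 \<ge> 0" "C2 \<ge> 0"
    using k c by (auto simp: C1_def C2_def)
  have "\<exists>u e. eigensystem (?A x) u e" if "x \<in> U" for x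
    using symmetric_eigensystem_exists[OF transpose_compliance[OF pd[OF that], of Q]] by blast
  \<comment> \<open>The choice is arbitrary at each point: the estimates compare two points directly
    and never follow an eigenvector along a path.\<close>
  then obtain u e where ue: "\<And>x. x \<in> U \<Longrightarrow> eigensystem (?A x) (u x) (e x)"
    by metis
  have uu: "u x a \<bullet> u x a' = (if a = a' then 1 else 0)" and Au: "?A x *v u x a = e x a *\<^sub>R u x a"
    if "x \<in> U" for x a a'
    using ue[OF that] by (auto simp: eigensystem_def)
  define z where "z x a = matrix_inv (stiffness Ks x) *v (Q *v u x a)" for x a
  define g where "g \<mu> x = smoothed_grad Ks Q \<mu> x (u x) (e x)" for \<mu> x
  have K_diff: "norm ((stiffness Ks y - stiffness Ks x) *v v) \<le> k * norm (y - x) * norm v" for x y v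
    unfolding stiffness_diff by (rule k)
  note perturbation = inverse_form_perturbation[OF pd pd c(1) c(2) c(2) _ K_diff, simplified stiffness_diff]
  have uAu: "u x a \<bullet> (?A x *v u x a) = e x a" if "x \<in> U" for x a
    using uu[OF that] Au[OF that] by simp
  have form_lower: "e x a - z x a \<bullet> (stiffness Ks (y - x) *v z x a) \<le> u x a \<bullet> (?A y *v u x a)"
    if "x \<in> U" "y \<in> U" for x y a
    using perturbation(2)[OF that that _ , of "Q *v u x a"] k(1) uAu[OF that(1), of a]
    by (simp add: compliance_inner z_def)
  have form_upper: "u x a \<bullet> ((?A y - ?A x) *v u x a)
      \<le> - (z x a \<bullet> (stiffness Ks (y - x) *v z x a)) + C2 * (norm (y - x))\<^sup>2"
    if "x \<in> U" "y \<in> U" for x y a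
  proof -
    have "(norm (Q *v u x a))\<^sup>2 \<le> q\<^sup>2"
      using q[of "u x a"] uu[OF that(1), of a a] by (intro power_mono) (auto simp: norm_eq_1[symmetric])
    then have "(k * norm (y - x))\<^sup>2 / c ^ 3 * (norm (Q *v u x a))\<^sup>2 \<le> (k * norm (y - x))\<^sup>2 / c ^ 3 * q\<^sup>2"
      using c(1) by (intro mult_left_mono) auto
    then show ?thesis
      using perturbation(3)[OF that that _ , of "Q *v u x a"] k(1)
      by (simp add: compliance_inner z_def matrix_vector_mult_diff_rdistrib inner_diff_right
          C2_def power_mult_distrib mult_ac)
  qed
  have A_diff: "norm ((?A y - ?A x) *v v) \<le> C1 * norm (y - x) * norm v"
    if "x \<in> U" "y \<in> U" for x y v
  proof -
    let ?w = "(?A y - ?A x) *v v"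
    let ?d = "matrix_inv (stiffness Ks y) *v (Q *v v) - matrix_inv (stiffness Ks x) *v (Q *v v)"
    have "norm ?d \<le> k * norm (y - x) / c\<^sup>2 * norm (Q *v v)"
      using perturbation(1)[OF that that _ , of "Q *v v"] k(1) by simp
    also have "\<dots> \<le> k * norm (y - x) / c\<^sup>2 * (q * norm v)"
      using q k(1) by (intro mult_left_mono) auto
    finally have d: "norm ?d \<le> k * norm (y - x) / c\<^sup>2 * (q * norm v)" .
    \<comment> \<open>Pairing the vector with itself moves the transpose of \<open>Q\<close> to the
      other side, so the bound \<open>q\<close> serves both factors; one \<open>norm ?w\<close> is
      cancelled at the end.\<close>
    have "norm ?w * norm ?w = ?w \<bullet> ?w"
      by (simp add: power2_norm_eq_inner[symmetric] power2_eq_square)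
    also have "\<dots> = (Q *v ?w) \<bullet> ?d"
      by (simp add: matrix_vector_mult_diff_rdistrib[of "?A y"] inner_diff_right compliance_inner)
    also have "\<dots> \<le> norm (Q *v ?w) * norm ?d"
      by (rule norm_cauchy_schwarz)
    also have "\<dots> \<le> (q * norm ?w) * (k * norm (y - x) / c\<^sup>2 * (q * norm v))"
      using q d \<open>q \<ge> 0\<close> by (intro mult_mono) auto
    also have "\<dots> = norm ?w * (C1 * norm (y - x) * norm v)"
      by (simp add: C1_def power2_eq_square)
    finally have *: "norm ?w * norm ?w \<le> norm ?w * (C1 * norm (y - x) * norm v)" .
    have "0 \<le> C1 * norm (y - x) * norm v"
      using C by simp
    then show ?thesis
      using * by (cases "norm ?w = 0") (simp, metis mult_le_cancel_left_pos norm_ge_zero order_le_less)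
  qed
  have g_inner: "g \<mu> x \<bullet> h = (\<Sum>a\<in>UNIV. exp (e x a / \<mu>) / (\<Sum>a\<in>UNIV. exp (e x a / \<mu>)) *
      - (z x a \<bullet> (stiffness Ks h *v z x a)))" for \<mu> x h
    by (simp add: g_def smoothed_grad_inner z_def Let_def)
  have f_eq: "smoothed Ks Q \<mu> x = \<mu> * ln (\<Sum>i\<in>UNIV. exp (e x i / \<mu>)) - \<mu> * ln (real CARD('n))"
    if "x \<in> U" "\<mu> > 0" for \<mu> x
    using smoothed_eigensystem[OF ue[OF that(1)], of \<mu>] that by simp
  have scaled: "eigensystem ((1 / \<mu>) *\<^sub>R ?A x) (u x) (\<lambda>i. e x i / \<mu>)" if "x \<in> U" for x \<mu>
    using eigensystem_scaleR[OF ue[OF that], of "1 / \<mu>"] by simp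
  have lower: "smoothed Ks Q \<mu> x + g \<mu> x \<bullet> (y - x) \<le> smoothed Ks Q \<mu> y"
    if "\<mu> > 0" "x \<in> U" "y \<in> U" for \<mu> x y
  proof -
    let ?s = "\<lambda>a. - (z x a \<bullet> (stiffness Ks (y - x) *v z x a)) / \<mu>"
    have "e x a / \<mu> + ?s a \<le> u x a \<bullet> (((1 / \<mu>) *\<^sub>R ?A y) *v u x a)" for a
      using divide_right_mono[OF form_lower[OF that(2,3), of a], of \<mu>] \<open>\<mu> > 0\<close>
      by (simp add: scaleR_matrix_vector_assoc [symmetric] diff_divide_distrib)
    from ln_trace_exp_ge[OF scaled[OF that(3)] uu[OF that(2)] this]
    have "ln (\<Sum>a\<in>UNIV. exp (e x a / \<mu>)) + g \<mu> x \<bullet> (y - x) / \<mu> \<le> ln (\<Sum>i\<in>UNIV. exp (e y i / \<mu>))"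
      by (simp add: g_inner sum_divide_distrib)
    then have "\<mu> * (ln (\<Sum>a\<in>UNIV. exp (e x a / \<mu>)) + g \<mu> x \<bullet> (y - x) / \<mu>)
        \<le> \<mu> * ln (\<Sum>i\<in>UNIV. exp (e y i / \<mu>))"
      using \<open>\<mu> > 0\<close> by (intro mult_left_mono) auto
    then show ?thesis
      using that by (simp add: f_eq distrib_left)
  qed
  have upper: "smoothed Ks Q \<mu> y \<le> smoothed Ks Q \<mu> x + g \<mu> x \<bullet> (y - x) + (C2 + 6 * C1\<^sup>2 / \<mu>) * (norm (y - x))\<^sup>2"
    if "\<mu> > 0" "x \<in> U" "y \<in> U" "C1 * norm (y - x) \<le> \<mu> / 2" for \<mu> x y
  proof -
    let ?H = "(1 / \<mu>) *\<^sub>R ?A y - (1 / \<mu>) *\<^sub>R ?A x"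
    let ?\<rho> = "\<lambda>a. exp (e x a / \<mu>) / (\<Sum>a\<in>UNIV. exp (e x a / \<mu>))"
    define \<eta> where "\<eta> = C1 * norm (y - x) / \<mu>"
    have H: "?H *v v = (1 / \<mu>) *\<^sub>R ((?A y - ?A x) *v v)" for v
      by (simp add: scaleR_diff_right [symmetric] scaleR_matrix_vector_assoc)
    have "norm (?H *v v) \<le> \<eta> * norm v" for v
      using divide_right_mono[OF A_diff[OF that(2,3), of v], of \<mu>] \<open>\<mu> > 0\<close> by (simp add: H \<eta>_def)
    moreover have "0 \<le> \<eta>" "\<eta> \<le> 1 / 2"
      using that C by (auto simp: \<eta>_def field_simps)
    ultimately have "ln (\<Sum>i\<in>UNIV. exp (e y i / \<mu>)) \<le> ln (\<Sum>a\<in>UNIV. exp (e x a / \<mu>))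
        + (\<Sum>a\<in>UNIV. ?\<rho> a * (u x a \<bullet> (?H *v u x a))) + 6 * \<eta>\<^sup>2"
      by (rule ln_trace_exp_le[OF scaled[OF that(2)] scaled[OF that(3)]])
    then have "\<mu> * ln (\<Sum>i\<in>UNIV. exp (e y i / \<mu>)) \<le> \<mu> * (ln (\<Sum>a\<in>UNIV. exp (e x a / \<mu>))
        + (\<Sum>a\<in>UNIV. ?\<rho> a * (u x a \<bullet> (?H *v u x a))) + 6 * \<eta>\<^sup>2)"
      using \<open>\<mu> > 0\<close> by (intro mult_left_mono) auto
    also have "\<dots> = \<mu> * ln (\<Sum>a\<in>UNIV. exp (e x a / \<mu>))
        + (\<Sum>a\<in>UNIV. ?\<rho> a * (u x a \<bullet> ((?A y - ?A x) *v u x a))) + 6 * C1\<^sup>2 / \<mu> * (norm (y - x))\<^sup>2"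
      using \<open>\<mu> > 0\<close> by (simp add: H distrib_left sum_distrib_left \<eta>_def power2_eq_square)
    finally have ln_le: "\<mu> * ln (\<Sum>i\<in>UNIV. exp (e y i / \<mu>)) \<le> \<dots>" .
    have sum_\<rho>: "(\<Sum>a\<in>UNIV. ?\<rho> a) = 1"
    proof -
      have "(\<Sum>a\<in>UNIV. exp (e x a / \<mu>)) > 0"
        by (auto intro!: sum_pos)
      then show ?thesis by (simp flip: sum_divide_distrib)
    qed
    have "(\<Sum>a\<in>UNIV. ?\<rho> a * (u x a \<bullet> ((?A y - ?A x) *v u x a)))
        \<le> (\<Sum>a\<in>UNIV. ?\<rho> a * (- (z x a \<bullet> (stiffness Ks (y - x) *v z x a)) + C2 * (norm (y - x))\<^sup>2))"
      using form_upper[OF that(2,3)] by (intro sum_mono mult_left_mono) (auto intro!: divide_nonneg_nonneg sum_nonneg)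
    also have "\<dots> = g \<mu> x \<bullet> (y - x) + (\<Sum>a\<in>UNIV. ?\<rho> a) * (C2 * (norm (y - x))\<^sup>2)"
      unfolding g_inner distrib_left sum.distrib sum_distrib_right ..
    finally show ?thesis
      using ln_le that by (simp add: f_eq sum_\<rho> distrib_right)
  qed
  define \<beta> where "\<beta> \<mu> = C2 + 6 * C1\<^sup>2 / \<mu>" for \<mu>
  \<comment> \<open>The first entry keeps nearby points in \<open>U\<close>, the second ensures the
    smallness premise of \<open>upper\<close>; \<open>C1\<close> may be 0, hence
    \<open>C1 + 1\<close>. The radius shrinks with \<mu>, but chaining local Lipschitz bounds keeps
    it out of the final constant.\<close>
  define r where "r \<mu> = min (xmin / 2) (\<mu> / (2 * (C1 + 1)))" for \<mu>
  have \<beta>: "\<beta> \<mu> \<ge> 0" and r: "r \<mu> > 0" if "\<mu> > 0" for \<mu>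
    using that C \<open>0 < xmin\<close> by (auto simp: \<beta>_def r_def)
  have near: "y \<in> U" if "x \<in> ?S" "norm (y - x) < r \<mu>" for x y \<mu>
  proof -
    have "xmin / 2 \<le> y $ j" for j
    proof -
      have "\<bar>(y - x) $ j\<bar> < xmin / 2"
        using that(2) component_le_norm_cart[of "y - x" j] by (simp add: r_def)
      moreover have "xmin \<le> x $ j"
        using that(1) by (simp add: feasible_def)
      ultimately show ?thesis
        unfolding vector_minus_component by linarith
    qed
    then show ?thesis by (simp add: U_def)
  qed
  have upper': "smoothed Ks Q \<mu> y \<le> smoothed Ks Q \<mu> x + g \<mu> x \<bullet> (y - x) + \<beta> \<mu> * (norm (y - x))\<^sup>2"
    if "\<mu> > 0" "x \<in> U" "y \<in> U" "norm (y - x) < r \<mu>" for \<mu> x y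
  proof -
    have "C1 * norm (y - x) \<le> (C1 + 1) * (\<mu> / (2 * (C1 + 1)))"
      using that(4) C by (intro mult_mono) (auto simp: r_def)
    also have "\<dots> = \<mu> / 2"
      using C by (simp add: field_simps)
    finally show ?thesis
      unfolding \<beta>_def using that by (intro upper)
  qed
  have "convex_on ?S (smoothed Ks Q \<mu>)" if "\<mu> > 0" for \<mu>
    using lower[OF that] S_U by (intro convex_on_if_supporting_hyperplanes[OF convex_feasible]) blast
  moreover have "GDERIV (smoothed Ks Q \<mu>) x :> g \<mu> x" if "\<mu> > 0" "x \<in> ?S" for \<mu> x
  proof (rule GDERIV_if_quadratic_remainder[OF r[OF that(1)]])
    fix y assume y: "norm (y - x) < r \<mu>"
    show "\<bar>smoothed Ks Q \<mu> y - smoothed Ks Q \<mu> x - g \<mu> x \<bullet> (y - x)\<bar> \<le> \<beta> \<mu> * (norm (y - x))\<^sup>2"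
      using lower[OF that(1), of x y] upper'[OF that(1) _ _ y] near[OF that(2) y] S_U that(2) by auto
  qed
  \<comment> \<open>This is \<open>2 * \<beta> \<mu>\<close> with 1 added to each constant, since
    \<open>C1\<close> and \<open>C2\<close> may vanish while both witnesses must be
    positive.\<close>
  moreover have "((2 * C2 + 1) + (12 * C1\<^sup>2 + 1) / \<mu>)-lipschitz_on ?S (g \<mu>)" if "\<mu> > 0" for \<mu>
  proof (rule lipschitz_on_mono[OF lipschitz_on_gradient_if_quadratic_bounds
        [OF convex_feasible r[OF that] \<beta>[OF that] near lower[OF that] upper'[OF that]] order.refl])
    show "2 * \<beta> \<mu> \<le> (2 * C2 + 1) + (12 * C1\<^sup>2 + 1) / \<mu>"
      using that by (simp add: \<beta>_def add_divide_distrib)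
  qed
  moreover have "0 < 2 * C2 + 1" "0 < 12 * C1\<^sup>2 + 1"
    using C by (auto intro: add_nonneg_pos)
  moreover have "0 \<le> smoothed Ks Q \<mu>2 x - smoothed Ks Q \<mu>1 x \<and>
      smoothed Ks Q \<mu>2 x - smoothed Ks Q \<mu>1 x \<le> ln (real CARD('n)) * (\<mu>1 - \<mu>2)"
    if "x \<in> ?S" "\<mu>1 \<ge> \<mu>2" "\<mu>2 \<ge> 0" for x \<mu>1 \<mu>2
    using smoothed_diff_bounds[OF pd that(3,2)] that(1) S_U by blast
  ultimately show ?thesis
    using compact_feasible[OF assms(3,5)] by blast
qed

end
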